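(* Let $W=(W_1,\ldots,W_m)$ be a score vector with null set $\mathcal H_0$ such that every null score is nonzero almost surely and, for every null $j$, both conditional probabilities $\mathbb P(W_j>0\mid|W_j|,W_{-j})$ and $\mathbb P(W_j<0\mid|W_j|,W_{-j})$ are positive almost surely. Fix $\alpha\in(0,1)$ and $\eta\in[0,\alpha)$. Let $\mathcal D$ be (calibration) data independent of the testing scores $W$, and let $\widehat M\in[1,\infty]$ be $\mathcal D$-measurable with $$\mathbb P(M_{\mathcal H_0}^-\le\widehat M)\ge1-\eta,$$ where $M_{\mathcal H_0}^-$ is defined in the context. Then running the knockoff+ threshold on $W$ at the level $q_{\rm run}=(\alpha-\eta)/\widehat M$, with $q_{\rm run}=0$ (no rejections) when $\widehat M=\infty$, gives $\mathrm{FDR}\le\alpha$.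
   Context: For $t>0$, put $N_+(t)=\#\{i:W_i\ge t\}$, $N_-(t)=\#\{i:W_i\le -t\}$, $\mathcal T=\{|W_i|:|W_i|>0\}$. The knockoff+ threshold at level $q$ is $\widehat t=\min\{t\in\mathcal T:(1+N_-(t))/(N_+(t)\vee1)\le q\}$, with $\widehat t=\infty$ if the set is empty; the rejection set is $\widehat{\mathcal R}=\{i:W_i\ge\widehat t\}$, and $\mathrm{FDR}=\mathbb E\{|\widehat{\mathcal R}\cap\mathcal H_0|/(|\widehat{\mathcal R}|\vee1)\}$, the expectation being over both $\mathcal D$ and $W$ when the level is random. Here $a\vee b=\max\{a,b\}$. $W_{-j}$ denotes all scores except $W_j$. For each null $j$, $\Omega_j=\mathbb P(W_j>0\mid|W_j|,W_{-j})/\mathbb P(W_j<0\mid|W_j|,W_{-j})$, and $$M_{\mathcal H_0}^-=\mathbb E\Big[1\vee\max_{j\in\mathcal H_0,\,W_j<0}\Omega_j\Big],$$ where the inner maximum is zero when its index set is empty; $M_{\mathcal H_0}^-$ is a (possibly infinite) constant determined by the law of $W$. *)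

theory Defs
  imports "HOL-Probability.Probability"
begin

text \<open>
  A score vector is a family \<open>W i\<close> of real random variables, \<open>i \<in> {1..m}\<close>; the values of \<open>W\<close>
  at other indices are never used. Lower-case \<open>w\<close> is a realisation of it.
\<close>

definition N_plus :: "nat \<Rightarrow> (nat \<Rightarrow> real) \<Rightarrow> real \<Rightarrow> nat" where
  "N_plus m w t = card {i \<in> {1..m}. w i \<ge> t}"

definition N_minus :: "nat \<Rightarrow> (nat \<Rightarrow> real) \<Rightarrow> real \<Rightarrow> nat" where
  "N_minus m w t = card {i \<in> {1..m}. w i \<le> - t}"

definition candidate_thresholds :: "nat \<Rightarrow> (nat \<Rightarrow> real) \<Rightarrow> real set" where
  "candidate_thresholds m w = {\<bar>w i\<bar> | i. i \<in> {1..m} \<and> \<bar>w i\<bar> > 0}"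

definition admissible_thresholds :: "nat \<Rightarrow> (nat \<Rightarrow> real) \<Rightarrow> real \<Rightarrow> real set" where
  "admissible_thresholds m w q =
     {t \<in> candidate_thresholds m w.
        (1 + real (N_minus m w t)) / real (max (N_plus m w t) 1) \<le> q}"

definition knockoff_plus_threshold :: "nat \<Rightarrow> (nat \<Rightarrow> real) \<Rightarrow> real \<Rightarrow> ereal" where
  "knockoff_plus_threshold m w q =
     (if admissible_thresholds m w q = {} then \<infinity>
      else ereal (Min (admissible_thresholds m w q)))"

definition rejections :: "nat \<Rightarrow> (nat \<Rightarrow> real) \<Rightarrow> real \<Rightarrow> nat set" where
  "rejections m w q = {i \<in> {1..m}. ereal (w i) \<ge> knockoff_plus_threshold m w q}"

text \<open>The level \<open>q\<close> is a random variable on the same probability space as the scores.\<close>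

definition FDR ::
    "'a measure \<Rightarrow> nat \<Rightarrow> nat set \<Rightarrow> (nat \<Rightarrow> 'a \<Rightarrow> real) \<Rightarrow> ('a \<Rightarrow> real) \<Rightarrow> real" where
  "FDR P m H0 W q =
     (\<integral>\<omega>. real (card (rejections m (\<lambda>i. W i \<omega>) (q \<omega>) \<inter> H0)) /
          real (max (card (rejections m (\<lambda>i. W i \<omega>) (q \<omega>))) 1) \<partial>P)"

definition score_vector :: "nat \<Rightarrow> (nat \<Rightarrow> 'a \<Rightarrow> real) \<Rightarrow> 'a \<Rightarrow> nat \<Rightarrow> real" where
  "score_vector m W \<omega> = (\<lambda>i\<in>{1..m}. W i \<omega>)"

text \<open>The sigma-algebra generated by \<open>\<bar>W j\<bar>\<close> together with all scores except \<open>W j\<close>.\<close>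

definition sign_masked_algebra ::
    "'a measure \<Rightarrow> nat \<Rightarrow> (nat \<Rightarrow> 'a \<Rightarrow> real) \<Rightarrow> nat \<Rightarrow> 'a measure" where
  "sign_masked_algebra P m W j =
     vimage_algebra (space P)
       (\<lambda>\<omega>. (\<bar>W j \<omega>\<bar>, \<lambda>i\<in>{1..m} - {j}. W i \<omega>))
       (borel \<Otimes>\<^sub>M (\<Pi>\<^sub>M i\<in>{1..m} - {j}. borel))"

definition cond_prob_pos ::
    "'a measure \<Rightarrow> nat \<Rightarrow> (nat \<Rightarrow> 'a \<Rightarrow> real) \<Rightarrow> nat \<Rightarrow> 'a \<Rightarrow> real" where
  "cond_prob_pos P m W j =
     real_cond_exp P (sign_masked_algebra P m W j) (indicator {\<omega> \<in> space P. W j \<omega> > 0})"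

definition cond_prob_neg ::
    "'a measure \<Rightarrow> nat \<Rightarrow> (nat \<Rightarrow> 'a \<Rightarrow> real) \<Rightarrow> nat \<Rightarrow> 'a \<Rightarrow> real" where
  "cond_prob_neg P m W j =
     real_cond_exp P (sign_masked_algebra P m W j) (indicator {\<omega> \<in> space P. W j \<omega> < 0})"

definition sign_odds ::
    "'a measure \<Rightarrow> nat \<Rightarrow> (nat \<Rightarrow> 'a \<Rightarrow> real) \<Rightarrow> nat \<Rightarrow> 'a \<Rightarrow> real" where
  "sign_odds P m W j \<omega> = cond_prob_pos P m W j \<omega> / cond_prob_neg P m W j \<omega>"

definition max_negative_null_odds ::
    "'a measure \<Rightarrow> nat \<Rightarrow> nat set \<Rightarrow> (nat \<Rightarrow> 'a \<Rightarrow> real) \<Rightarrow> 'a \<Rightarrow> real" where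
  "max_negative_null_odds P m H0 W \<omega> =
     (if {j \<in> H0. W j \<omega> < 0} = {} then 0
      else Max ((\<lambda>j. sign_odds P m W j \<omega>) ` {j \<in> H0. W j \<omega> < 0}))"

text \<open>A nonnegative integral, because the expectation may be infinite.\<close>

definition M_minus ::
    "'a measure \<Rightarrow> nat \<Rightarrow> nat set \<Rightarrow> (nat \<Rightarrow> 'a \<Rightarrow> real) \<Rightarrow> ennreal" where
  "M_minus P m H0 W = (\<integral>\<^sup>+\<omega>. ennreal (max 1 (max_negative_null_odds P m H0 W \<omega>)) \<partial>P)"

definition run_level :: "real \<Rightarrow> real \<Rightarrow> ennreal \<Rightarrow> real" where
  "run_level \<alpha> \<eta> M = (if M = \<infinity> then 0 else (\<alpha> - \<eta>) / enn2real M)"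

end

theory Submission
  imports Defs
begin

text \<open>
  Let \<open>T j\<close> be the threshold computed after replacing \<open>W j\<close> by \<open>\<bar>W j\<bar>\<close>. At a fixed level \<open>q\<close> the
  false discovery proportion is at most \<open>q\<close> times the sum over nulls \<open>j\<close> with \<open>W j \<ge> T j\<close> of
  \<open>1 / (1 + #{null k \<noteq> j. W k \<le> - T j})\<close>. Apart from the sign of \<open>W j\<close>, each summand depends only on
  \<open>\<bar>W j\<bar>\<close> and the other scores, so in expectation the sign can be swapped at the cost of the odds
  \<open>\<Omega> j\<close>. Nulls with \<open>W j \<le> - T j\<close> all share one threshold, so the swapped weights add up to at most
  \<open>1\<close> and the total is bounded by the largest odds of a negative null. For the random level,
  integrate over the independent calibration data and pay \<open>\<eta>\<close> for the event \<open>Mhat < M_minus\<close>.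
\<close>

section \<open>Elementary facts about the knockoff+ threshold\<close>

lemma finite_candidate_thresholds [simp]: "finite (candidate_thresholds m w)"
  unfolding candidate_thresholds_def by simp

lemma finite_admissible_thresholds [simp]: "finite (admissible_thresholds m w q)"
  unfolding admissible_thresholds_def by simp

lemma admissible_threshold_pos: "t \<in> admissible_thresholds m w q \<Longrightarrow> 0 < t"
  by (auto simp: admissible_thresholds_def candidate_thresholds_def)

text \<open>Replaces the minimum by an existential. The infinite threshold is covered too: with no
  admissible value both sides are false.\<close>

lemma threshold_le_iff:
  "knockoff_plus_threshold m w q \<le> ereal x \<longleftrightarrow> (\<exists>t\<in>admissible_thresholds m w q. t \<le> x)"
  unfolding knockoff_plus_threshold_def by (auto simp: Min_le_iff)

lemma threshold_cases:
  obtains "admissible_thresholds m w q = {}" "knockoff_plus_threshold m w q = \<infinity>"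
  | t where "t \<in> admissible_thresholds m w q" "knockoff_plus_threshold m w q = ereal t" "0 < t"
proof (cases "admissible_thresholds m w q = {}")
  case True
  then show ?thesis using that(1) by (simp add: knockoff_plus_threshold_def)
next
  case False
  then have "Min (admissible_thresholds m w q) \<in> admissible_thresholds m w q" by simp
  from that(2)[OF this _ admissible_threshold_pos[OF this]] False show ?thesis
    by (simp add: knockoff_plus_threshold_def)
qed

lemma threshold_pos: "0 < knockoff_plus_threshold m w q"
  by (rule threshold_cases[of m w q]) auto

lemma threshold_le_imp_pos: "knockoff_plus_threshold m w q \<le> ereal x \<Longrightarrow> 0 < x"
  using threshold_pos[of m w q] order_less_le_trans by fastforce

section \<open>Pathwise bound on the false discovery proportion by null weights\<close>

definition FDP :: "nat \<Rightarrow> nat set \<Rightarrow> (nat \<Rightarrow> real) \<Rightarrow> real \<Rightarrow> real" where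
  "FDP m H0 w q =
     real (card (rejections m w q \<inter> H0)) / real (max (card (rejections m w q)) 1)"

text \<open>In the first branch \<open>w j\<close> is positive because thresholds are, so
  \<open>j\<close> itself is never counted in the denominator. Comparisons in \<open>ereal\<close>
  make the weight 0 when the threshold is infinite.\<close>

definition null_weight :: "nat \<Rightarrow> nat set \<Rightarrow> real \<Rightarrow> (nat \<Rightarrow> real) \<Rightarrow> nat \<Rightarrow> real" where
  "null_weight m H0 q w j =
     (if knockoff_plus_threshold m w q \<le> ereal (w j)
      then 1 / (1 + real (card {k \<in> H0. knockoff_plus_threshold m w q \<le> ereal (- w k)}))
      else 0)"

lemma null_weight_nonneg: "0 \<le> null_weight m H0 q w j"
  by (simp add: null_weight_def)

lemma FDP_le_1: "FDP m H0 w q \<le> 1"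
proof -
  have "finite (rejections m w q)" by (simp add: rejections_def)
  then have "card (rejections m w q \<inter> H0) \<le> card (rejections m w q)"
    by (intro card_mono) auto
  then have "real (card (rejections m w q \<inter> H0)) \<le> real (max (card (rejections m w q)) 1)"
    by simp
  then show ?thesis unfolding FDP_def by (intro divide_le_eq_1_pos[THEN iffD2]) auto
qed

lemma FDP_le_sum_null_weight:
  assumes H0: "H0 \<subseteq> {1..m}" and "0 \<le> q"
  shows "FDP m H0 w q \<le> q * (\<Sum>j\<in>H0. null_weight m H0 q w j)"
proof (rule threshold_cases[of m w q])
  assume "knockoff_plus_threshold m w q = \<infinity>"
  then show ?thesis
    using \<open>0 \<le> q\<close> by (simp add: FDP_def rejections_def null_weight_def)
next
  fix t assume t: "t \<in> admissible_thresholds m w q"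
    and T: "knockoff_plus_threshold m w q = ereal t"
  have "finite H0" using H0 finite_subset by blast
  define R where "R = rejections m w q"
  define V where "V = {k \<in> H0. t \<le> - w k}"
  have R: "R = {i \<in> {1..m}. t \<le> w i}" by (simp add: R_def rejections_def T)
  \<comment> \<open>Negative nulls are among all the negatives that knockoff+ counts, so
    admissibility of \<open>t\<close> survives with \<open>card V\<close> in the numerator.\<close>
  have "card V \<le> N_minus m w t"
    unfolding V_def N_minus_def using H0 by (intro card_mono) auto
  moreover have "(1 + real (N_minus m w t)) / real (max (card R) 1) \<le> q"
    using t by (simp add: admissible_thresholds_def N_plus_def R)
  ultimately have "(1 + real (card V)) / real (max (card R) 1) \<le> q"
    by (meson add_left_mono divide_right_mono of_nat_0_le_iff of_nat_le_iff order_trans)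
  then have "1 / real (max (card R) 1) \<le> q / (1 + real (card V))"
    by (simp add: field_simps)
  then have "real (card (R \<inter> H0)) * (1 / real (max (card R) 1))
      \<le> real (card (R \<inter> H0)) * (q / (1 + real (card V)))"
    by (intro mult_left_mono) auto
  \<comment> \<open>For one vector \<open>w\<close> the threshold is common to all nulls, so every
    rejected null carries the same weight and every other null carries 0.\<close>
  moreover have "(\<Sum>j\<in>H0. null_weight m H0 q w j) = real (card (R \<inter> H0)) / (1 + real (card V))"
  proof -
    have "R \<inter> H0 = {j \<in> H0. t \<le> w j}" using H0 R by auto
    then show ?thesis
      using \<open>finite H0\<close>
      by (simp add: null_weight_def T V_def sum.If_cases Int_def)
  qed
  ultimately show ?thesis by (simp add: FDP_def R_def mult.commute)
qed

section \<open>Effect of making a single score nonnegative\<close>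

lemma candidate_thresholds_abs_upd:
  "candidate_thresholds m (w(j := \<bar>w j\<bar>)) = candidate_thresholds m w"
proof -
  have "\<bar>(w(j := \<bar>w j\<bar>)) i\<bar> = \<bar>w i\<bar>" for i by simp
  then show ?thesis unfolding candidate_thresholds_def by presburger
qed

lemma N_plus_abs_upd:
  assumes "j \<in> {1..m}" "0 < t" "w j \<le> - t"
  shows "N_plus m (w(j := \<bar>w j\<bar>)) t = Suc (N_plus m w t)"
proof -
  have "{i \<in> {1..m}. t \<le> (w(j := \<bar>w j\<bar>)) i} = insert j {i \<in> {1..m}. t \<le> w i}"
    using assms by auto
  then show ?thesis using assms by (simp add: N_plus_def)
qed

text \<open>The subtraction of naturals never truncates, since \<open>j\<close> is itself counted in
  \<open>N_minus m w t\<close>.\<close>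

lemma N_minus_abs_upd:
  assumes "j \<in> {1..m}" "0 < t" "w j \<le> - t"
  shows "N_minus m (w(j := \<bar>w j\<bar>)) t = N_minus m w t - 1"
proof -
  have "{i \<in> {1..m}. (w(j := \<bar>w j\<bar>)) i \<le> - t} = {i \<in> {1..m}. w i \<le> - t} - {j}"
    using assms by auto
  then show ?thesis using assms by (simp add: N_minus_def)
qed

text \<open>When both scores lie at or below \<open>- t\<close>, flipping either one raises
  \<open>N_plus\<close> at \<open>t\<close> by one and lowers \<open>N_minus\<close> at
  \<open>t\<close> by one. The candidate set does not change, so the two ratios at \<open>t\<close>
  coincide.\<close>

lemma admissible_thresholds_abs_upd_swap:
  assumes "j \<in> {1..m}" "k \<in> {1..m}" "w j \<le> - t" "w k \<le> - t"
    and t: "t \<in> admissible_thresholds m (w(j := \<bar>w j\<bar>)) q"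
  shows "t \<in> admissible_thresholds m (w(k := \<bar>w k\<bar>)) q"
  using t assms(1-4) admissible_threshold_pos[OF t]
  unfolding admissible_thresholds_def
  by (simp add: candidate_thresholds_abs_upd N_plus_abs_upd N_minus_abs_upd del: abs_of_nonpos abs_of_neg)

text \<open>The smaller of the two thresholds lies below both \<open>- w j\<close> and
  \<open>- w k\<close>, so by the preceding swap it is admissible for the other flipped vector as
  well. The other threshold therefore cannot be larger.\<close>

lemma threshold_abs_upd_eq:
  assumes "j \<in> {1..m}" "k \<in> {1..m}"
    and j: "knockoff_plus_threshold m (w(j := \<bar>w j\<bar>)) q \<le> ereal (- w j)"
    and k: "knockoff_plus_threshold m (w(k := \<bar>w k\<bar>)) q \<le> ereal (- w k)"
  shows "knockoff_plus_threshold m (w(j := \<bar>w j\<bar>)) q = knockoff_plus_threshold m (w(k := \<bar>w k\<bar>)) q"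
proof -
  \<comment> \<open>The case in which \<open>a\<close> has the smaller threshold; the two orders of
    \<open>j\<close> and \<open>k\<close> are both instances of it.\<close>
  have le: "knockoff_plus_threshold m (w(b := \<bar>w b\<bar>)) q \<le> knockoff_plus_threshold m (w(a := \<bar>w a\<bar>)) q"
    if "a \<in> {1..m}" "b \<in> {1..m}"
      and a: "knockoff_plus_threshold m (w(a := \<bar>w a\<bar>)) q \<le> ereal (- w a)"
      and b: "knockoff_plus_threshold m (w(b := \<bar>w b\<bar>)) q \<le> ereal (- w b)"
      and ab: "knockoff_plus_threshold m (w(a := \<bar>w a\<bar>)) q \<le> knockoff_plus_threshold m (w(b := \<bar>w b\<bar>)) q"
    for a b
  proof (rule threshold_cases[of m "w(a := \<bar>w a\<bar>)" q])
    assume "knockoff_plus_threshold m (w(a := \<bar>w a\<bar>)) q = \<infinity>"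
    then show ?thesis by simp
  next
    fix t assume t: "t \<in> admissible_thresholds m (w(a := \<bar>w a\<bar>)) q"
      and T: "knockoff_plus_threshold m (w(a := \<bar>w a\<bar>)) q = ereal t"
    have "w a \<le> - t" using a T by simp
    moreover have "ereal t \<le> ereal (- w b)" using order_trans[OF ab b] T by simp
    then have "w b \<le> - t" by simp
    ultimately have "t \<in> admissible_thresholds m (w(b := \<bar>w b\<bar>)) q"
      using admissible_thresholds_abs_upd_swap t that(1,2) by blast
    then show ?thesis unfolding T threshold_le_iff by auto
  qed
  show ?thesis
    using le[OF assms(1,2) j k] le[OF assms(2,1) k j] by (meson antisym linear)
qed

text \<open>The nulls that contribute share one threshold, so each of them counts all the others in
  its denominator. With \<open>card J\<close> contributors, each weight is at most
  \<open>1 / card J\<close>.\<close>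

lemma sum_null_weight_abs_upd_le_1:
  assumes H0: "H0 \<subseteq> {1..m}"
  shows "(\<Sum>j | j \<in> H0 \<and> w j < 0. null_weight m H0 q (w(j := \<bar>w j\<bar>)) j) \<le> 1"
proof -
  have "finite H0" using H0 finite_subset by blast
  define T where "T j = knockoff_plus_threshold m (w(j := \<bar>w j\<bar>)) q" for j
  \<comment> \<open>The indices with a nonzero summand: for \<open>w j < 0\<close> the updated entry
    at \<open>j\<close> is \<open>- w j\<close>.\<close>
  define J where "J = {j \<in> H0. w j < 0 \<and> T j \<le> ereal (- w j)}"
  have "finite J" using \<open>finite H0\<close> by (simp add: J_def)
  have "null_weight m H0 q (w(j := \<bar>w j\<bar>)) j \<le> 1 / real (card J)" if "j \<in> J" for j
  proof -
    define V where "V = {k \<in> H0. T j \<le> ereal (- (w(j := \<bar>w j\<bar>)) k)}"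
    \<comment> \<open>Another member \<open>k\<close> of \<open>J\<close> satisfies
      \<open>T j = T k \<le> - w k\<close>, and the update at \<open>j\<close> leaves
      \<open>w k\<close> alone.\<close>
    have "J - {j} \<subseteq> V"
    proof
      fix k assume k: "k \<in> J - {j}"
      then have "T j = T k"
        using that H0 unfolding T_def J_def
        by (intro threshold_abs_upd_eq) (auto simp: T_def)
      then show "k \<in> V" using k by (auto simp: V_def J_def)
    qed
    then have "card (J - {j}) \<le> card V"
      using \<open>finite H0\<close> by (intro card_mono) (simp_all add: V_def)
    then have "card J \<le> 1 + card V"
      using that \<open>finite J\<close> by simp
    moreover have "0 < card J" using that \<open>finite J\<close> card_gt_0_iff by blast
    ultimately have "1 / (1 + real (card V)) \<le> 1 / real (card J)"
      by (intro divide_left_mono) (auto simp flip: of_nat_Suc)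
    moreover have "T j \<le> ereal ((w(j := \<bar>w j\<bar>)) j)"
      using that by (simp add: J_def)
    then have "null_weight m H0 q (w(j := \<bar>w j\<bar>)) j = 1 / (1 + real (card V))"
      by (simp only: null_weight_def T_def V_def if_True)
    ultimately show ?thesis by simp
  qed
  then have "(\<Sum>j\<in>J. null_weight m H0 q (w(j := \<bar>w j\<bar>)) j) \<le> real (card J) * (1 / real (card J))"
    by (rule sum_bounded_above)
  moreover have "(\<Sum>j | j \<in> H0 \<and> w j < 0. null_weight m H0 q (w(j := \<bar>w j\<bar>)) j)
      = (\<Sum>j\<in>J. null_weight m H0 q (w(j := \<bar>w j\<bar>)) j)"
    using \<open>finite H0\<close>
    by (intro sum.mono_neutral_right) (auto simp: J_def T_def null_weight_def)
  \<comment> \<open>The bound \<open>card J * (1 / card J)\<close> is 1, or 0 when \<open>J\<close>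
    is empty.\<close>
  ultimately show ?thesis by (simp split: if_splits)
qed

text \<open>Isolates the sign of \<open>w j\<close> in the indicator. For \<open>w j > 0\<close> the
  update changes nothing; otherwise the weight vanishes because thresholds are positive.\<close>

lemma null_weight_eq_abs_upd:
  "null_weight m H0 q w j = null_weight m H0 q (w(j := \<bar>w j\<bar>)) j * indicator {0<..} (w j)"
proof (cases "0 < w j")
  case True
  then have "w(j := \<bar>w j\<bar>) = w" by auto
  with True show ?thesis by simp
next
  case False
  then show ?thesis using threshold_le_imp_pos[of m w q "w j"] by (auto simp: null_weight_def)
qed

section \<open>Measurability of thresholds, weights and proportions\<close>

lemma real_card_filter: "finite A \<Longrightarrow> real (card {i \<in> A. Q i}) = (\<Sum>i\<in>A. if Q i then 1 else 0)"
  by (simp add: sum.If_cases Int_def)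

text \<open>The candidate set is random, but it is indexed by \<open>{1..m}\<close>. The event is
  thus a finite union over \<open>i\<close> of the events that \<open>\<bar>u x i\<bar>\<close> is
  admissible and at most \<open>y x\<close>.\<close>

lemma measurable_threshold_le:
  fixes u :: "'b \<Rightarrow> nat \<Rightarrow> real"
  assumes u: "\<And>i. i \<in> {1..m} \<Longrightarrow> (\<lambda>x. u x i) \<in> borel_measurable M"
    and [measurable]: "q \<in> borel_measurable M" "y \<in> borel_measurable M"
  shows "Measurable.pred M (\<lambda>x. knockoff_plus_threshold m (u x) (q x) \<le> ereal (y x))"
proof -
  have [measurable]: "Measurable.pred M (\<lambda>x. \<bar>u x i\<bar> \<in> admissible_thresholds m (u x) (q x))"
    if i: "i \<in> {1..m}" for i
  proof -
    note [measurable] = u[OF i]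
    have [measurable]: "(\<lambda>x. real (N_plus m (u x) \<bar>u x i\<bar>)) \<in> borel_measurable M"
      unfolding N_plus_def real_card_filter[OF finite_atLeastAtMost]
    proof (rule borel_measurable_sum)
      fix k assume "k \<in> {1..m}"
      note [measurable] = u[OF this]
      show "(\<lambda>x. if \<bar>u x i\<bar> \<le> u x k then 1 else 0 :: real) \<in> borel_measurable M" by measurable
    qed
    have [measurable]: "(\<lambda>x. real (N_minus m (u x) \<bar>u x i\<bar>)) \<in> borel_measurable M"
      unfolding N_minus_def real_card_filter[OF finite_atLeastAtMost]
    proof (rule borel_measurable_sum)
      fix k assume "k \<in> {1..m}"
      note [measurable] = u[OF this]
      show "(\<lambda>x. if u x k \<le> - \<bar>u x i\<bar> then 1 else 0 :: real) \<in> borel_measurable M" by measurable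
    qed
    have "\<bar>u x i\<bar> \<in> admissible_thresholds m (u x) (q x) \<longleftrightarrow> 0 < \<bar>u x i\<bar> \<and>
        (1 + real (N_minus m (u x) \<bar>u x i\<bar>)) / max (real (N_plus m (u x) \<bar>u x i\<bar>)) 1 \<le> q x" for x
      using i by (auto simp: admissible_thresholds_def candidate_thresholds_def of_nat_max)
    then show ?thesis by simp
  qed
  have "knockoff_plus_threshold m (u x) (q x) \<le> ereal (y x) \<longleftrightarrow>
      (\<exists>i\<in>{1..m}. \<bar>u x i\<bar> \<in> admissible_thresholds m (u x) (q x) \<and> \<bar>u x i\<bar> \<le> y x)" for x
    unfolding threshold_le_iff by (auto simp: admissible_thresholds_def candidate_thresholds_def)
  moreover have "Measurable.pred M
      (\<lambda>x. \<exists>i\<in>{1..m}. \<bar>u x i\<bar> \<in> admissible_thresholds m (u x) (q x) \<and> \<bar>u x i\<bar> \<le> y x)"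
  proof (intro pred_intros_finite)
    fix i assume i: "i \<in> {1..m}"
    note [measurable] = u[OF i]
    show "Measurable.pred M (\<lambda>x. \<bar>u x i\<bar> \<in> admissible_thresholds m (u x) (q x) \<and> \<bar>u x i\<bar> \<le> y x)"
      using i by measurable
  qed simp
  ultimately show ?thesis by simp
qed

text \<open>The family \<open>u\<close> and the measure \<open>M\<close> are arbitrary so that the
  flipped score vector over the sign-masked algebra is an instance.\<close>

lemma measurable_null_weight:
  fixes u :: "'b \<Rightarrow> nat \<Rightarrow> real"
  assumes u: "\<And>i. i \<in> {1..m} \<Longrightarrow> (\<lambda>x. u x i) \<in> borel_measurable M"
    and H0: "H0 \<subseteq> {1..m}" and j: "j \<in> {1..m}"
  shows "(\<lambda>x. null_weight m H0 q (u x) j) \<in> borel_measurable M"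
proof -
  have "finite H0" using H0 finite_subset by blast
  have [measurable]: "Measurable.pred M (\<lambda>x. knockoff_plus_threshold m (u x) q \<le> ereal (u x j))"
    using j by (intro measurable_threshold_le u) auto
  have "(\<lambda>x. \<Sum>k\<in>H0. if knockoff_plus_threshold m (u x) q \<le> ereal (- u x k) then 1 else 0 :: real)
      \<in> borel_measurable M"
  proof (rule borel_measurable_sum)
    fix k assume "k \<in> H0"
    then have "k \<in> {1..m}" using H0 by auto
    note [measurable] = u[OF this]
    have [measurable]: "Measurable.pred M (\<lambda>x. knockoff_plus_threshold m (u x) q \<le> ereal (- u x k))"
      by (intro measurable_threshold_le u) auto
    show "(\<lambda>x. if knockoff_plus_threshold m (u x) q \<le> ereal (- u x k) then 1 else 0 :: real)
        \<in> borel_measurable M" by measurable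
  qed
  note [measurable] = this
  show ?thesis
    unfolding null_weight_def real_card_filter[OF \<open>finite H0\<close>] by measurable
qed

text \<open>Here the level varies with the point: integrating out the scores at a frozen level
  requires joint measurability in level and scores.\<close>

lemma measurable_FDP:
  fixes u :: "'b \<Rightarrow> nat \<Rightarrow> real"
  assumes u: "\<And>i. i \<in> {1..m} \<Longrightarrow> (\<lambda>x. u x i) \<in> borel_measurable M"
    and H0: "H0 \<subseteq> {1..m}"
    and q: "q \<in> borel_measurable M"
  shows "(\<lambda>x. FDP m H0 (u x) (q x)) \<in> borel_measurable M"
proof -
  have count: "(\<lambda>x. real (card {i \<in> A. knockoff_plus_threshold m (u x) (q x) \<le> ereal (u x i)}))
      \<in> borel_measurable M" if A: "A \<subseteq> {1..m}" for A
  proof -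
    have "finite A" using A finite_subset by blast
    show ?thesis unfolding real_card_filter[OF \<open>finite A\<close>]
    proof (rule borel_measurable_sum)
      fix i assume "i \<in> A"
      then have "i \<in> {1..m}" using A by auto
      have [measurable]: "Measurable.pred M (\<lambda>x. knockoff_plus_threshold m (u x) (q x) \<le> ereal (u x i))"
        by (intro measurable_threshold_le u q \<open>i \<in> {1..m}\<close>)
      show "(\<lambda>x. if knockoff_plus_threshold m (u x) (q x) \<le> ereal (u x i) then 1 else 0 :: real)
          \<in> borel_measurable M" by measurable
    qed
  qed
  have "rejections m w r \<inter> H0 = {i \<in> H0. knockoff_plus_threshold m w r \<le> ereal (w i)}" for w r
    using H0 by (auto simp: rejections_def)
  then have FDP: "FDP m H0 w r = real (card {i \<in> H0. knockoff_plus_threshold m w r \<le> ereal (w i)}) /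
      max (real (card {i \<in> {1..m}. knockoff_plus_threshold m w r \<le> ereal (w i)})) 1" for w r
    by (simp add: FDP_def rejections_def of_nat_max)
  note [measurable] = count[OF H0] count[OF order_refl]
  show ?thesis unfolding FDP by measurable
qed

section \<open>Sign swapping by conditional expectation, and the bound at a fixed level\<close>

lemma (in finite_measure_subalgebra) real_cond_exp_indicator_AE:
  assumes [measurable]: "A \<in> sets M"
  shows "AE x in M. ennreal (real_cond_exp M F (indicator A) x) = nn_cond_exp M F (indicator A) x"
proof -
  \<comment> \<open>This is the part that \<open>real_cond_exp\<close> subtracts;
    \<open>ennreal\<close> truncates \<open>- indicator A\<close> to 0.\<close>
  have "AE x in M. nn_cond_exp M F (\<lambda>x. ennreal (- indicator A x)) x = 0"
    using nn_cond_exp_F_meas[of "\<lambda>_. 0"]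
    by (simp add: ennreal_neg)
  \<comment> \<open>Finiteness ensures that passing through the reals and back to
    \<open>ennreal\<close> loses nothing.\<close>
  moreover have "AE x in M. nn_cond_exp M F (indicator A) x \<noteq> \<infinity>"
  proof (rule nn_integral_noteq_infinite)
    have "(\<integral>\<^sup>+x. nn_cond_exp M F (indicator A) x \<partial>M) = (\<integral>\<^sup>+x. indicator A x \<partial>M)"
      using nn_cond_exp_intg[of "\<lambda>_. 1" "indicator A"] by simp
    then show "(\<integral>\<^sup>+x. nn_cond_exp M F (indicator A) x \<partial>M) \<noteq> \<infinity>"
      by simp
  qed measurable
  ultimately show ?thesis
    by eventually_elim (simp add: real_cond_exp_def ennreal_indicator less_top)
qed

lemma subalgebra_sign_masked_algebra:
  assumes W: "\<And>i. i \<in> {1..m} \<Longrightarrow> W i \<in> borel_measurable P" and j: "j \<in> {1..m}"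
  shows "subalgebra P (sign_masked_algebra P m W j)"
proof -
  note [measurable] = W[OF j]
  have "(\<lambda>\<omega>. \<lambda>i\<in>{1..m} - {j}. W i \<omega>) \<in> measurable P (\<Pi>\<^sub>M i\<in>{1..m} - {j}. borel)"
    using W by (intro measurable_restrict) auto
  note [measurable] = this
  have "(\<lambda>\<omega>. (\<bar>W j \<omega>\<bar>, \<lambda>i\<in>{1..m} - {j}. W i \<omega>)) \<in>
      measurable P (borel \<Otimes>\<^sub>M (\<Pi>\<^sub>M i\<in>{1..m} - {j}. borel))"
    by measurable
  then show ?thesis
    unfolding subalgebra_def sign_masked_algebra_def
    by (simp add: sets_image_in_sets)
qed

text \<open>The flipped vector is a function of exactly what the algebra reveals:
  \<open>\<bar>W j\<bar>\<close> at index \<open>j\<close> and the remaining scores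
  elsewhere.\<close>

lemma measurable_abs_upd_sign_masked_algebra:
  assumes "i \<in> {1..m}"
  shows "(\<lambda>\<omega>. ((\<lambda>i. W i \<omega>)(j := \<bar>W j \<omega>\<bar>)) i) \<in> borel_measurable (sign_masked_algebra P m W j)"
proof -
  let ?X = "\<lambda>\<omega>. (\<bar>W j \<omega>\<bar>, \<lambda>i\<in>{1..m} - {j}. W i \<omega>)"
  have X: "?X \<in> measurable (sign_masked_algebra P m W j) (borel \<Otimes>\<^sub>M (\<Pi>\<^sub>M i\<in>{1..m} - {j}. borel))"
    unfolding sign_masked_algebra_def
    by (intro measurable_vimage_algebra1) (auto simp: space_pair_measure space_PiM)
  show ?thesis
  proof (cases "i = j")
    case True
    then show ?thesis using measurable_compose[OF X measurable_fst] by simp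
  next
    case False
    then have "i \<in> {1..m} - {j}" using assms by simp
    from measurable_compose[OF measurable_compose[OF X measurable_snd] measurable_component_singleton[OF this]]
    show ?thesis using False assms by simp
  qed
qed

text \<open>Since \<open>g\<close> and the odds are measurable for the masked algebra, each sign
  indicator may be exchanged for its conditional probability under the integral. The odds turn the
  negative probability into the positive one.\<close>

lemma nn_integral_sign_swap:
  assumes "prob_space P"
    and W: "\<And>i. i \<in> {1..m} \<Longrightarrow> W i \<in> borel_measurable P" and j: "j \<in> {1..m}"
    and neg: "AE \<omega> in P. cond_prob_neg P m W j \<omega> > 0"
    and g [measurable]: "g \<in> borel_measurable (sign_masked_algebra P m W j)"
  shows "(\<integral>\<^sup>+\<omega>. g \<omega> * indicator {\<omega> \<in> space P. W j \<omega> > 0} \<omega> \<partial>P) =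
    (\<integral>\<^sup>+\<omega>. g \<omega> * ennreal (sign_odds P m W j \<omega>) * indicator {\<omega> \<in> space P. W j \<omega> < 0} \<omega> \<partial>P)"
proof -
  let ?F = "sign_masked_algebra P m W j"
  let ?p = "\<lambda>\<omega>. ennreal (cond_prob_pos P m W j \<omega>)"
  let ?n = "\<lambda>\<omega>. ennreal (cond_prob_neg P m W j \<omega>)"
  let ?A = "{\<omega> \<in> space P. W j \<omega> > 0}" and ?B = "{\<omega> \<in> space P. W j \<omega> < 0}"
  interpret prob_space P by fact
  interpret finite_measure_subalgebra P ?F
    by unfold_locales (rule subalgebra_sign_masked_algebra[OF W j])
  note [measurable] = W[OF j]
  have A [measurable]: "?A \<in> sets P" and B [measurable]: "?B \<in> sets P" by measurable
  have p: "AE \<omega> in P. ?p \<omega> = nn_cond_exp P ?F (indicator ?A) \<omega>"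
    using real_cond_exp_indicator_AE[OF A] by (simp add: cond_prob_pos_def)
  have n: "AE \<omega> in P. ?n \<omega> = nn_cond_exp P ?F (indicator ?B) \<omega>"
    using real_cond_exp_indicator_AE[OF B] by (simp add: cond_prob_neg_def)
  have [measurable]: "sign_odds P m W j \<in> borel_measurable ?F"
    unfolding sign_odds_def cond_prob_pos_def cond_prob_neg_def by measurable
  have "(\<integral>\<^sup>+\<omega>. g \<omega> * indicator ?A \<omega> \<partial>P) = (\<integral>\<^sup>+\<omega>. g \<omega> * nn_cond_exp P ?F (indicator ?A) \<omega> \<partial>P)"
    by (rule nn_cond_exp_intg[symmetric]) auto
  also have "\<dots> = (\<integral>\<^sup>+\<omega>. g \<omega> * ennreal (sign_odds P m W j \<omega>) * nn_cond_exp P ?F (indicator ?B) \<omega> \<partial>P)"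
  proof (rule nn_integral_cong_AE)
    show "AE \<omega> in P. g \<omega> * nn_cond_exp P ?F (indicator ?A) \<omega> =
        g \<omega> * ennreal (sign_odds P m W j \<omega>) * nn_cond_exp P ?F (indicator ?B) \<omega>"
      using p n neg
    proof eventually_elim
      case (elim \<omega>)
      \<comment> \<open>The denominator of the odds cancels because it is positive almost
        everywhere.\<close>
      have "ennreal (sign_odds P m W j \<omega>) * ?n \<omega> = ?p \<omega>"
        using elim(3) by (simp add: sign_odds_def flip: ennreal_mult'')
      then show ?case by (simp add: mult.assoc flip: elim(1,2))
    qed
  qed
  also have "\<dots> = (\<integral>\<^sup>+\<omega>. g \<omega> * ennreal (sign_odds P m W j \<omega>) * indicator ?B \<omega> \<partial>P)"
    by (rule nn_cond_exp_intg) auto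
  finally show ?thesis .
qed

text \<open>Working in \<open>ennreal\<close> admits an infinite \<open>M_minus\<close>. At
  \<open>q = 0\<close> the right-hand side is 0 even then, consistent with there being no
  rejections.\<close>

lemma nn_integral_FDP_le:
  assumes "prob_space P"
    and W: "\<And>i. i \<in> {1..m} \<Longrightarrow> W i \<in> borel_measurable P" and H0: "H0 \<subseteq> {1..m}"
    and neg: "\<And>j. j \<in> H0 \<Longrightarrow> AE \<omega> in P. cond_prob_neg P m W j \<omega> > 0"
    and "0 \<le> q"
  shows "(\<integral>\<^sup>+\<omega>. ennreal (FDP m H0 (\<lambda>i. W i \<omega>) q) \<partial>P) \<le> ennreal q * M_minus P m H0 W"
proof -
  interpret prob_space P by fact
  have "finite H0" using H0 finite_subset by blast
  define g where "g j \<omega> = null_weight m H0 q ((\<lambda>i. W i \<omega>)(j := \<bar>W j \<omega>\<bar>)) j" for j \<omega>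
  have g_nonneg: "0 \<le> g j \<omega>" for j \<omega> by (simp add: g_def null_weight_nonneg)
  have g_F: "g j \<in> borel_measurable (sign_masked_algebra P m W j)" if "j \<in> H0" for j
    unfolding g_def using that H0
    by (intro measurable_null_weight measurable_abs_upd_sign_masked_algebra) auto
  have g_P [measurable]: "g j \<in> borel_measurable P" if "j \<in> H0" for j
    using measurable_from_subalg[OF subalgebra_sign_masked_algebra[OF W] g_F[OF that]] that H0 by blast
  have W_P [measurable]: "W j \<in> borel_measurable P" if "j \<in> H0" for j
    using that H0 W by blast
  have odds_P [measurable]: "sign_odds P m W j \<in> borel_measurable P" for j
    unfolding sign_odds_def cond_prob_pos_def cond_prob_neg_def by measurable
  let ?O = "\<lambda>\<omega>. max 1 (max_negative_null_odds P m H0 W \<omega>)"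
  have pointwise: "(\<Sum>j\<in>H0. ennreal (g j \<omega>) * ennreal (sign_odds P m W j \<omega>) *
      indicator {\<omega> \<in> space P. W j \<omega> < 0} \<omega>) \<le> ennreal (?O \<omega>)" if "\<omega> \<in> space P" for \<omega>
  proof -
    let ?J = "{j \<in> H0. W j \<omega> < 0}"
    have "sign_odds P m W j \<omega> \<le> ?O \<omega>" if "j \<in> ?J" for j
    proof -
      have "sign_odds P m W j \<omega> \<le> Max ((\<lambda>j. sign_odds P m W j \<omega>) ` ?J)"
        using that \<open>finite H0\<close> by (intro Max_ge) auto
      then show ?thesis using that by (auto simp: max_negative_null_odds_def)
    qed
    then have "(\<Sum>j\<in>?J. ennreal (g j \<omega>) * ennreal (sign_odds P m W j \<omega>))
        \<le> (\<Sum>j\<in>?J. ennreal (g j \<omega>) * ennreal (?O \<omega>))"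
      by (intro sum_mono mult_left_mono ennreal_leI) auto
    also have "\<dots> = ennreal (\<Sum>j\<in>?J. g j \<omega>) * ennreal (?O \<omega>)"
      by (simp add: g_nonneg flip: sum_distrib_right)
    \<comment> \<open>After the swap only negative nulls remain, and their flipped weights add up to
      at most 1.\<close>
    also have "\<dots> \<le> 1 * ennreal (?O \<omega>)"
      using sum_null_weight_abs_upd_le_1[OF H0, where w="\<lambda>i. W i \<omega>" and q=q]
      by (intro mult_right_mono) (simp_all add: g_def)
    finally have "(\<Sum>j\<in>?J. ennreal (g j \<omega>) * ennreal (sign_odds P m W j \<omega>)) \<le> ennreal (?O \<omega>)"
      by simp
    moreover have "(\<Sum>j\<in>H0. ennreal (g j \<omega>) * ennreal (sign_odds P m W j \<omega>) *
        indicator {\<omega> \<in> space P. W j \<omega> < 0} \<omega>) =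
        (\<Sum>j\<in>?J. ennreal (g j \<omega>) * ennreal (sign_odds P m W j \<omega>))"
      using \<open>finite H0\<close> that by (intro sum.mono_neutral_cong_right) auto
    ultimately show ?thesis by simp
  qed
  have "(\<integral>\<^sup>+\<omega>. ennreal (FDP m H0 (\<lambda>i. W i \<omega>) q) \<partial>P) \<le>
      (\<integral>\<^sup>+\<omega>. ennreal q * (\<Sum>j\<in>H0. ennreal (g j \<omega>) * indicator {\<omega> \<in> space P. W j \<omega> > 0} \<omega>) \<partial>P)"
  proof (rule nn_integral_mono)
    fix \<omega> assume "\<omega> \<in> space P"
    have "null_weight m H0 q (\<lambda>i. W i \<omega>) j = g j \<omega> * indicator {\<omega> \<in> space P. W j \<omega> > 0} \<omega>" for j
      using \<open>\<omega> \<in> space P\<close> null_weight_eq_abs_upd[of m H0 q "\<lambda>i. W i \<omega>" j]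
      by (simp add: g_def indicator_def)
    then have "FDP m H0 (\<lambda>i. W i \<omega>) q
        \<le> q * (\<Sum>j\<in>H0. g j \<omega> * indicator {\<omega> \<in> space P. W j \<omega> > 0} \<omega>)"
      using FDP_le_sum_null_weight[OF H0 \<open>0 \<le> q\<close>, of "\<lambda>i. W i \<omega>"] by simp
    then have "ennreal (FDP m H0 (\<lambda>i. W i \<omega>) q)
        \<le> ennreal (q * (\<Sum>j\<in>H0. g j \<omega> * indicator {\<omega> \<in> space P. W j \<omega> > 0} \<omega>))"
      by (rule ennreal_leI)
    also have "\<dots> = ennreal q * (\<Sum>j\<in>H0. ennreal (g j \<omega>) * indicator {\<omega> \<in> space P. W j \<omega> > 0} \<omega>)"
      using \<open>0 \<le> q\<close> by (simp add: ennreal_mult' g_nonneg ennreal_indicator flip: sum_ennreal)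
    finally show "ennreal (FDP m H0 (\<lambda>i. W i \<omega>) q)
        \<le> ennreal q * (\<Sum>j\<in>H0. ennreal (g j \<omega>) * indicator {\<omega> \<in> space P. W j \<omega> > 0} \<omega>)" .
  qed
  also have "\<dots> = ennreal q * (\<Sum>j\<in>H0. \<integral>\<^sup>+\<omega>. ennreal (g j \<omega>) * indicator {\<omega> \<in> space P. W j \<omega> > 0} \<omega> \<partial>P)"
    by (subst nn_integral_cmult, measurable) (subst nn_integral_sum, measurable)
  \<comment> \<open>The swap is made one null at a time, since each \<open>j\<close> has its own
    masked algebra.\<close>
  also have "\<dots> = ennreal q * (\<Sum>j\<in>H0. \<integral>\<^sup>+\<omega>. ennreal (g j \<omega>) * ennreal (sign_odds P m W j \<omega>) *
      indicator {\<omega> \<in> space P. W j \<omega> < 0} \<omega> \<partial>P)"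
    using H0 g_F by (intro arg_cong2[where f="(*)"] sum.cong refl nn_integral_sign_swap
        \<open>prob_space P\<close> W neg measurable_compose[OF _ measurable_ennreal]) auto
  \<comment> \<open>The sum returns under the integral because the weights are controlled only
    jointly, at each \<open>\<omega>\<close>.\<close>
  also have "\<dots> = ennreal q * (\<integral>\<^sup>+\<omega>. (\<Sum>j\<in>H0. ennreal (g j \<omega>) * ennreal (sign_odds P m W j \<omega>) *
      indicator {\<omega> \<in> space P. W j \<omega> < 0} \<omega>) \<partial>P)"
  proof (subst nn_integral_sum)
    fix j assume "j \<in> H0"
    note [measurable] = W_P[OF this] g_P[OF this]
    show "(\<lambda>\<omega>. ennreal (g j \<omega>) * ennreal (sign_odds P m W j \<omega>) *
        indicator {\<omega> \<in> space P. W j \<omega> < 0} \<omega>) \<in> borel_measurable P"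
      by measurable
  qed simp
  also have "\<dots> \<le> ennreal q * M_minus P m H0 W"
    unfolding M_minus_def by (intro mult_left_mono nn_integral_mono pointwise) auto
  finally show ?thesis .
qed

section \<open>Independent calibration data and the random level\<close>

lemma (in prob_space) nn_integral_indep_iterate:
  assumes X [measurable]: "X \<in> measurable M S" and Y [measurable]: "Y \<in> measurable M T"
    and indep: "\<And>A B. A \<in> sets S \<Longrightarrow> B \<in> sets T \<Longrightarrow>
      prob ((X -` A \<inter> space M) \<inter> (Y -` B \<inter> space M)) = prob (X -` A \<inter> space M) * prob (Y -` B \<inter> space M)"
    and f [measurable]: "f \<in> borel_measurable (S \<Otimes>\<^sub>M T)"
  shows "(\<integral>\<^sup>+\<omega>. f (X \<omega>, Y \<omega>) \<partial>M) = (\<integral>\<^sup>+\<omega>'. (\<integral>\<^sup>+\<omega>. f (X \<omega>', Y \<omega>) \<partial>M) \<partial>M)"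
proof -
  interpret X: prob_space "distr M S X" by (rule prob_space_distr) simp
  interpret Y: prob_space "distr M T Y" by (rule prob_space_distr) simp
  \<comment> \<open>Independence is the product rule on rectangles, which determines the joint law;
    Tonelli then applies to the product of the two laws.\<close>
  have distr: "distr M S X \<Otimes>\<^sub>M distr M T Y = distr M (S \<Otimes>\<^sub>M T) (\<lambda>\<omega>. (X \<omega>, Y \<omega>))"
  proof (rule pair_measure_eqI)
    fix A B assume "A \<in> sets (distr M S X)" "B \<in> sets (distr M T Y)"
    then have AB [measurable]: "A \<in> sets S" "B \<in> sets T" by simp_all
    have "(\<lambda>\<omega>. (X \<omega>, Y \<omega>)) -` (A \<times> B) \<inter> space M = (X -` A \<inter> space M) \<inter> (Y -` B \<inter> space M)"
      by auto
    then show "emeasure (distr M S X) A * emeasure (distr M T Y) B =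
        emeasure (distr M (S \<Otimes>\<^sub>M T) (\<lambda>\<omega>. (X \<omega>, Y \<omega>))) (A \<times> B)"
      using indep[OF AB] by (simp add: emeasure_distr emeasure_eq_measure ennreal_mult)
  qed (simp_all add: X.sigma_finite_measure_axioms Y.sigma_finite_measure_axioms cong: sets_pair_measure_cong)
  have "(\<integral>\<^sup>+\<omega>. f (X \<omega>, Y \<omega>) \<partial>M) = (\<integral>\<^sup>+z. f z \<partial>(distr M S X \<Otimes>\<^sub>M distr M T Y))"
    unfolding distr by (simp add: nn_integral_distr)
  also have "\<dots> = (\<integral>\<^sup>+x. (\<integral>\<^sup>+y. f (x, y) \<partial>distr M T Y) \<partial>distr M S X)"
    by (rule Y.nn_integral_fst[symmetric]) simp
  also have "\<dots> = (\<integral>\<^sup>+\<omega>'. (\<integral>\<^sup>+y. f (X \<omega>', y) \<partial>distr M T Y) \<partial>M)"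
    by (rule nn_integral_distr) (simp_all add: Y.borel_measurable_nn_integral_fst)
  also have "\<dots> = (\<integral>\<^sup>+\<omega>'. (\<integral>\<^sup>+\<omega>. f (X \<omega>', Y \<omega>) \<partial>M) \<partial>M)"
    by (intro nn_integral_cong nn_integral_distr)
      (auto intro: measurable_compose[OF _ f] dest: measurable_space[OF X])
  finally show ?thesis .
qed

text \<open>\<open>score_vector\<close> is \<open>undefined\<close> off \<open>{1..m}\<close>, as a
  point of the product space must be, while the proportion reads scores only at indices in
  \<open>{1..m}\<close>.\<close>

lemma FDP_score_vector: "FDP m H0 (score_vector m W \<omega>) q = FDP m H0 (\<lambda>i. W i \<omega>) q"
proof -
  let ?s = "score_vector m W \<omega>" and ?w = "\<lambda>i. W i \<omega>"
  have eq: "?s i = W i \<omega>" if "i \<in> {1..m}" for i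
    using that by (simp add: score_vector_def)
  have "candidate_thresholds m ?s = candidate_thresholds m ?w"
    unfolding candidate_thresholds_def by (auto simp: eq) (metis atLeastAtMost_iff eq One_nat_def)+
  moreover have "N_plus m ?s = N_plus m ?w" "N_minus m ?s = N_minus m ?w"
    unfolding N_plus_def N_minus_def
    by (intro ext arg_cong[where f=card] Collect_cong conj_cong refl; simp add: eq)+
  ultimately have "knockoff_plus_threshold m ?s q = knockoff_plus_threshold m ?w q"
    by (simp add: knockoff_plus_threshold_def admissible_thresholds_def)
  then have "rejections m ?s q = rejections m ?w q"
    unfolding rejections_def by (intro Collect_cong conj_cong refl) (simp add: eq)
  then show ?thesis by (simp add: FDP_def)
qed

lemma run_level_nonneg: "\<eta> \<le> \<alpha> \<Longrightarrow> 0 \<le> run_level \<alpha> \<eta> M"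
  by (simp add: run_level_def)

text \<open>For finite \<open>M\<close> the product of level and \<open>M\<close> is exactly
  \<open>\<alpha> - \<eta>\<close>, with \<open>1 \<le> M\<close> excluding division by zero. For
  infinite \<open>M\<close> the level is 0, and the product is 0 even if \<open>M'\<close> is
  infinite.\<close>

lemma run_level_mult_le:
  assumes "\<eta> \<le> \<alpha>" "1 \<le> M" "M' \<le> M"
  shows "ennreal (run_level \<alpha> \<eta> M) * M' \<le> ennreal (\<alpha> - \<eta>)"
proof (cases M)
  case (real r)
  then have "1 \<le> r" using assms(2) by (simp flip: ennreal_1)
  have "ennreal (run_level \<alpha> \<eta> M) * M' \<le> ennreal (run_level \<alpha> \<eta> M) * M"
    by (intro mult_left_mono assms) simp
  also have "\<dots> = ennreal (\<alpha> - \<eta>)"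
    using real \<open>1 \<le> r\<close> assms(1) by (simp add: run_level_def flip: ennreal_mult')
  finally show ?thesis .
qed (simp add: run_level_def)

lemma measurable_run_level [measurable]: "run_level \<alpha> \<eta> \<in> borel_measurable borel"
  unfolding run_level_def by measurable

theorem corollary6:
  fixes P :: "'a measure"
    and m :: nat
    and W :: "nat \<Rightarrow> 'a \<Rightarrow> real"
    and H0 :: "nat set"
    and \<alpha> \<eta> :: real
    and N :: "'d measure"
    and D :: "'a \<Rightarrow> 'd"
    and Mhat :: "'a \<Rightarrow> ennreal"
  assumes "prob_space P"
    and "\<And>i. i \<in> {1..m} \<Longrightarrow> W i \<in> borel_measurable P"
    and "H0 \<subseteq> {1..m}"
    and "\<And>j. j \<in> H0 \<Longrightarrow> AE \<omega> in P. W j \<omega> \<noteq> 0"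
    and "\<And>j. j \<in> H0 \<Longrightarrow> AE \<omega> in P. cond_prob_pos P m W j \<omega> > 0"
    and "\<And>j. j \<in> H0 \<Longrightarrow> AE \<omega> in P. cond_prob_neg P m W j \<omega> > 0"
    and "0 < \<alpha>" and "\<alpha> < 1" and "0 \<le> \<eta>" and "\<eta> < \<alpha>"
    and "D \<in> measurable P N"
    and "prob_space.indep_set P
           (sets (vimage_algebra (space P) D N))
           (sets (vimage_algebra (space P) (score_vector m W) (\<Pi>\<^sub>M i\<in>{1..m}. borel)))"
    and "Mhat \<in> borel_measurable (vimage_algebra (space P) D N)"
    and "\<And>\<omega>. \<omega> \<in> space P \<Longrightarrow> 1 \<le> Mhat \<omega>"
    and "measure P {\<omega> \<in> space P. M_minus P m H0 W \<le> Mhat \<omega>} \<ge> 1 - \<eta>"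
  shows "FDR P m H0 W (\<lambda>\<omega>. run_level \<alpha> \<eta> (Mhat \<omega>)) \<le> \<alpha>"
proof -
  interpret prob_space P by fact
  let ?M = "M_minus P m H0 W"
  let ?q = "\<lambda>\<omega>. run_level \<alpha> \<eta> (Mhat \<omega>)"
  let ?G = "{\<omega> \<in> space P. ?M \<le> Mhat \<omega>}"
  let ?D = "vimage_algebra (space P) D N"
  let ?T = "\<Pi>\<^sub>M i\<in>{1..m}. borel :: real measure"
  have D_sub: "sets ?D \<subseteq> events"
    using assms(11) by (intro sets_image_in_sets) auto
  have Mhat_meas [measurable]: "Mhat \<in> borel_measurable P"
    using assms(13) by (rule measurable_from_subalg[rotated]) (simp add: subalgebra_def D_sub)
  have W_meas: "score_vector m W \<in> measurable P ?T"
    unfolding score_vector_def using assms(2) by (intro measurable_restrict) auto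
  \<comment> \<open>\<open>Mhat\<close> is measurable for the algebra of \<open>D\<close>, so its
    events inherit independence from the scores.\<close>
  have indep: "prob ((Mhat -` A \<inter> space P) \<inter> (score_vector m W -` B \<inter> space P)) =
      prob (Mhat -` A \<inter> space P) * prob (score_vector m W -` B \<inter> space P)"
    if "A \<in> sets borel" "B \<in> sets ?T" for A B
  proof -
    have "Mhat -` A \<inter> space P \<in> sets ?D"
      using measurable_sets[OF assms(13) that(1)] by simp
    moreover have "score_vector m W -` B \<inter> space P \<in> sets (vimage_algebra (space P) (score_vector m W) ?T)"
      using that(2) by (rule in_vimage_algebra)
    ultimately show ?thesis using assms(12) unfolding indep_sets2_eq by blast
  qed
  have f_meas: "(\<lambda>(M, u). ennreal (FDP m H0 u (run_level \<alpha> \<eta> M))) \<in> borel_measurable (borel \<Otimes>\<^sub>M ?T)"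
    unfolding case_prod_beta
    by (intro measurable_compose[OF _ measurable_ennreal] measurable_FDP assms(3)) measurable
  \<comment> \<open>The level is frozen at \<open>\<omega>'\<close> while the scores are integrated
    over \<open>\<omega>\<close>.\<close>
  have "(\<integral>\<^sup>+\<omega>. ennreal (FDP m H0 (\<lambda>i. W i \<omega>) (?q \<omega>)) \<partial>P) =
      (\<integral>\<^sup>+\<omega>'. (\<integral>\<^sup>+\<omega>. ennreal (FDP m H0 (\<lambda>i. W i \<omega>) (?q \<omega>')) \<partial>P) \<partial>P)"
    using nn_integral_indep_iterate[OF Mhat_meas W_meas indep f_meas] by (simp add: FDP_score_vector)
  \<comment> \<open>On \<open>?G\<close> the fixed-level bound gives at most
    \<open>\<alpha> - \<eta>\<close>; off \<open>?G\<close> only the trivial bound 1 is available,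
    and the indicator pays for it.\<close>
  also have "\<dots> \<le> (\<integral>\<^sup>+\<omega>'. ennreal (\<alpha> - \<eta>) + indicator (space P - ?G) \<omega>' \<partial>P)"
  proof (rule nn_integral_mono)
    fix \<omega>' assume \<omega>': "\<omega>' \<in> space P"
    show "(\<integral>\<^sup>+\<omega>. ennreal (FDP m H0 (\<lambda>i. W i \<omega>) (?q \<omega>')) \<partial>P)
        \<le> ennreal (\<alpha> - \<eta>) + indicator (space P - ?G) \<omega>'"
    proof (cases "?M \<le> Mhat \<omega>'")
      case True
      have "(\<integral>\<^sup>+\<omega>. ennreal (FDP m H0 (\<lambda>i. W i \<omega>) (?q \<omega>')) \<partial>P) \<le> ennreal (?q \<omega>') * ?M"
        using assms(10) by (intro nn_integral_FDP_le assms(1-3,6) run_level_nonneg) auto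
      also have "\<dots> \<le> ennreal (\<alpha> - \<eta>)"
        using assms(10) \<omega>' by (intro run_level_mult_le assms(14) True) auto
      finally show ?thesis by (simp add: add_increasing2)
    next
      case False
      have "(\<integral>\<^sup>+\<omega>. ennreal (FDP m H0 (\<lambda>i. W i \<omega>) (?q \<omega>')) \<partial>P) \<le> (\<integral>\<^sup>+\<omega>. 1 \<partial>P)"
        by (intro nn_integral_mono) (simp add: FDP_le_1)
      then show ?thesis
        using False \<omega>' by (simp add: emeasure_space_1 add_increasing)
    qed
  qed
  also have "\<dots> = ennreal (\<alpha> - \<eta>) + emeasure P (space P - ?G)"
    by (subst nn_integral_add) (auto simp: emeasure_space_1)
  \<comment> \<open>The calibration guarantee bounds the probability of the complement of
    \<open>?G\<close> by \<open>\<eta>\<close>, the amount held back in the run level.\<close>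
  also have "\<dots> \<le> ennreal (\<alpha> - \<eta>) + ennreal \<eta>"
  proof -
    have "prob (space P - ?G) \<le> \<eta>"
      using assms(15) by (subst prob_compl) auto
    then show ?thesis by (intro add_left_mono) (simp add: emeasure_eq_measure ennreal_leI)
  qed
  also have "\<dots> = ennreal \<alpha>"
    using assms(9,10) by (simp flip: ennreal_plus)
  finally show ?thesis
    unfolding FDR_def FDP_def[symmetric] using assms(7) by (intro integral_real_bounded) auto
qed

end
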